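(* Let $T=\{1,\dots,m\}$, let $a_t\in\mathbb{R}^n$ ($t\in T$) and $c\in\mathbb{R}^n$ be fixed with $-c\in\mathrm{cone}\{a_t: t\in T\}$, and consider the linear programs $LP(b)$: minimize $\langle c,x\rangle$ subject to $x\in\mathcal{F}(b)$, $b\in\mathbb{R}^T$, with feasible set mapping $\mathcal{F}$, optimal solution mapping $\mathcal{S}$ and (single-valued on its domain) optimal value mapping $\mathcal{P}$ (see context). For any $(\overline{b},\overline{x})\in\mathrm{gph}\,\mathcal{S}$ we have $$\partial\mathcal{P}(\overline{b})=\|c\|_*\,\partial\mathcal{F}(\overline{b},\overline{x}).$$
   Context: $\mathbb{R}^n$ carries an arbitrary norm with dual norm $\|\cdot\|_*$, $\mathbb{R}$ carries the absolute value, $\mathbb{R}^T$ carries the supremum norm. $\mathcal{F}(b):=\{x\in\mathbb{R}^n:\langle a_t,x\rangle\le b_t,\ t\in T\}$; $\mathcal{S}(b)$ is the set of optimal solutions of $LP(b)$; $\vartheta(b):=\inf\{\langle c,x\rangle: x\in\mathcal{F}(b)\}$; $\mathcal{P}(b):=\{\langle c,x\rangle: x\in\mathcal{S}(b)\}$, i.e. $\mathcal{P}(b)=\{\vartheta(b)\}$ if $\mathcal{S}(b)\ne\emptyset$ and $\mathcal{P}(b)=\emptyset$ otherwise. $\mathrm{cone}$ denotes the convex conic hull. $\mathcal{E}_{\mathcal{P}}(b):=\mathcal{P}(b)+[0,\infty)$ and $\mathcal{E}_{\mathcal{F}}(b):=\mathcal{F}(b)+\{c\}^\circ$, where $\{c\}^\circ=\{u\in\mathbb{R}^n:\langle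 c,u\rangle\ge0\}$. The graph of a set-valued mapping $\mathcal{M}$ is $\mathrm{gph}\,\mathcal{M}=\{(y,z): z\in\mathcal{M}(y)\}$. For a convex set $\Omega$ and $\overline{w}\in\Omega$, $N(\overline{w};\Omega)=\{w^*:\langle w^*,w-\overline{w}\rangle\le0\ \forall w\in\Omega\}$. For $\mathcal{M}$ with convex graph, $y^*\in D^*\mathcal{M}(\overline{y},\overline{z})(z^* )\iff(y^*,-z^* )\in N((\overline{y},\overline{z});\mathrm{gph}\,\mathcal{M})$. Both $\mathcal{E}_{\mathcal{P}}$ and $\mathcal{E}_{\mathcal{F}}$ have convex graphs. For $\mathcal{M}\in\{\mathcal{F},\mathcal{P}\}$ with ordering cone $\Theta=\{c\}^\circ$ for $\mathcal{F}$ and $\Theta=[0,\infty)$ for $\mathcal{P}$, the subdifferential at $(\overline{b},\overline{z})\in\mathrm{gph}\,\mathcal{E}_{\mathcal{M}}$ is $$\partial\mathcal{M}(\overline{b},\overline{z}):=\{y\in\mathbb{R}^T: y\in D^*\mathcal{E}_{\mathcal{M}}(\overline{b},\overline{z})(z^* )\ \text{for some } z^*\text{ with }-z^*\in N(0;\Theta),\ \|z^*\|_*=1\},$$ and $\partial\mathcal{P}(\overline{b}):=\partial\mathcal{P}(\overline{b},\vartheta(\overline{b}))$.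
   Formalization: The formal statement assumes c ≠ 0; for c = 0 the printed equality always fails, because {c}° is the whole space, no unit z* exists and ∂F(b,x) is empty, while 0 belongs to ∂P(b). *)

theory Defs
  imports "HOL-Analysis.Analysis"
begin

text \<open>
  The norm on the decision space is arbitrary, so it is an explicit function; the class operation
  \<^const>\<open>norm\<close> is the Euclidean norm on \<^typ>\<open>real^'n\<close>. Dual vectors are represented
  through the inner product. The supremum norm on the parameter space \<^typ>\<open>real^'m\<close> does not
  occur in any of the notions below.
\<close>

definition is_norm :: "('a::real_vector \<Rightarrow> real) \<Rightarrow> bool" where
  "is_norm N \<longleftrightarrow>
     (\<forall>x. N x \<ge> 0) \<and>
     (\<forall>x. N x = 0 \<longleftrightarrow> x = 0) \<and>
     (\<forall>r x. N (r *\<^sub>R x) = \<bar>r\<bar> * N x) \<and>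
     (\<forall>x y. N (x + y) \<le> N x + N y)"

definition dual_norm :: "('a::real_inner \<Rightarrow> real) \<Rightarrow> 'a \<Rightarrow> real" where
  "dual_norm N u = Sup {u \<bullet> x | x. N x \<le> 1}"

definition normal_cone :: "'a::real_inner \<Rightarrow> 'a set \<Rightarrow> 'a set" where
  "normal_cone w \<Omega> = {w'. \<forall>v\<in>\<Omega>. w' \<bullet> (v - w) \<le> 0}"

definition gph :: "('a \<Rightarrow> 'b set) \<Rightarrow> ('a \<times> 'b) set" where
  "gph M = {(y, z). z \<in> M y}"

definition coderivative ::
  "('a::real_inner \<Rightarrow> 'b::real_inner set) \<Rightarrow> 'a \<Rightarrow> 'b \<Rightarrow> 'b \<Rightarrow> 'a set" where
  "coderivative M y z z' = {y'. (y', - z') \<in> normal_cone (y, z) (gph M)}"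

text \<open>The addition of sets below is the Minkowski sum.\<close>

definition epi_map :: "'b::real_vector set \<Rightarrow> ('a \<Rightarrow> 'b set) \<Rightarrow> 'a \<Rightarrow> 'b set" where
  "epi_map \<Theta> M y = M y + \<Theta>"

definition subdifferential ::
  "('b::real_inner \<Rightarrow> real) \<Rightarrow> 'b set \<Rightarrow> ('a::real_inner \<Rightarrow> 'b set) \<Rightarrow> 'a \<Rightarrow> 'b \<Rightarrow> 'a set" where
  "subdifferential N \<Theta> M y z =
     {y'. \<exists>z'. y' \<in> coderivative (epi_map \<Theta> M) y z z' \<and>
               - z' \<in> normal_cone 0 \<Theta> \<and> dual_norm N z' = 1}"

definition feasible :: "('m \<Rightarrow> real^'n) \<Rightarrow> real^'m \<Rightarrow> (real^'n) set" where
  "feasible a b = {x. \<forall>t. a t \<bullet> x \<le> b $ t}"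

definition solutions :: "('m \<Rightarrow> real^'n) \<Rightarrow> real^'n \<Rightarrow> real^'m \<Rightarrow> (real^'n) set" where
  "solutions a c b = {x \<in> feasible a b. \<forall>y\<in>feasible a b. c \<bullet> x \<le> c \<bullet> y}"

text \<open>
  This is a real infimum, so it is meaningful only if the problem is feasible and bounded below.
\<close>

definition opt_val :: "('m \<Rightarrow> real^'n) \<Rightarrow> real^'n \<Rightarrow> real^'m \<Rightarrow> real" where
  "opt_val a c b = (INF x\<in>feasible a b. c \<bullet> x)"

definition opt_val_map :: "('m \<Rightarrow> real^'n) \<Rightarrow> real^'n \<Rightarrow> real^'m \<Rightarrow> real set" where
  "opt_val_map a c b = {c \<bullet> x | x. x \<in> solutions a c b}"

definition polar_halfspace :: "real^'n \<Rightarrow> (real^'n) set" where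
  "polar_halfspace c = {u. c \<bullet> u \<ge> 0}"

definition subdiff_feasible ::
  "(real^'n \<Rightarrow> real) \<Rightarrow> ('m::finite \<Rightarrow> real^'n) \<Rightarrow> real^'n \<Rightarrow> real^'m \<Rightarrow> real^'n \<Rightarrow> (real^'m) set" where
  "subdiff_feasible N a c b x = subdifferential N (polar_halfspace c) (feasible a) b x"

definition subdiff_opt_val ::
  "('m::finite \<Rightarrow> real^'n) \<Rightarrow> real^'n \<Rightarrow> real^'m \<Rightarrow> (real^'m) set" where
  "subdiff_opt_val a c b = subdifferential abs {0..} (opt_val_map a c) b (opt_val a c b)"

end

theory Submission
  imports Defs
begin

text \<open>
  Both subdifferentials turn out to be sets of vectors that satisfy a family of linear inequalities.
  Let \<^term>\<open>\<kappa>\<close> be the dual norm of \<^term>\<open>c\<close>. The scalar dual vector in the definition of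
  \<^const>\<open>subdiff_opt_val\<close> is nonnegative of absolute value 1, so it is 1, and
  \<^term>\<open>y\<close> is a subgradient of the optimal value iff
    \<open>y \<bullet> (b' - b) \<le> c \<bullet> x' - c \<bullet> x\<close>
  for all \<open>b'\<close> and all optimal solutions \<open>x'\<close> of \<open>LP(b')\<close>. The dual vector in the definition of
  \<^const>\<open>subdiff_feasible\<close> is normal to a half-space, hence a nonnegative multiple of \<^term>\<open>c\<close>,
  and the normalisation makes it \<open>c / \<kappa>\<close>. So \<^term>\<open>y\<close> is a subgradient of the feasible set mapping
  iff \<open>\<kappa> * y\<close> satisfies the same inequality for all \<open>b'\<close> and all \<^emph>\<open>feasible\<close> points \<open>x'\<close> of \<open>LP(b')\<close>.

  The two families of inequalities are equivalent because every feasible problem attains its minimum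
  (\<open>solutions_nonempty_iff_feasible\<close>), and the inequality at a minimiser is the
  strongest one for a given \<open>b'\<close>. The hypothesis on \<^term>\<open>- c\<close> is dual feasibility and bounds the
  objective from below. Attainment then follows from closedness of finitely generated convex cones: the set of
  pairs consisting of a right-hand side and the objective value of a point feasible for it is such a cone
  (\<open>lp_values_convex_cone\<close>), so the objective values for a fixed right-hand side form a closed set.
\<close>

section \<open>Norms and dual norms\<close>

lemma is_norm_abs: "is_norm (abs :: real \<Rightarrow> real)"
  by (auto simp: is_norm_def abs_mult abs_triangle_ineq)

text \<open>
  A norm on a finite-dimensional space is convex, hence continuous, so it attains a positive minimum
  on the compact Euclidean unit sphere.
\<close>

lemma is_norm_lower_bound:
  fixes N :: "'a::euclidean_space \<Rightarrow> real"
  assumes "is_norm N"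
  obtains k where "k > 0" "\<And>x. k * norm x \<le> N x"
proof -
  have nonneg: "N x \<ge> 0" and zero: "N x = 0 \<longleftrightarrow> x = 0" and scale: "N (r *\<^sub>R x) = \<bar>r\<bar> * N x"
    and triangle: "N (x + y) \<le> N x + N y" for x y r
    using assms by (auto simp: is_norm_def)
  have "convex_on UNIV N"
    by (rule convex_onI) (use triangle scale in \<open>auto, smt (verit)\<close>)
  then have "continuous_on (sphere 0 1) N"
    by (meson continuous_on_subset convex_on_continuous open_UNIV top_greatest)
  moreover obtain e :: 'a where "e \<in> Basis"
    using nonempty_Basis by blast
  then have "sphere (0::'a) 1 \<noteq> {}"
    by auto
  ultimately obtain u where u: "u \<in> sphere 0 1" "\<And>v. v \<in> sphere 0 1 \<Longrightarrow> N u \<le> N v"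
    using continuous_attains_inf[OF compact_sphere] by blast
  show thesis
  proof
    show "N u > 0"
      using u(1) nonneg[of u] zero[of u] by force
    fix x
    show "N u * norm x \<le> N x"
    proof (cases "x = 0")
      case False
      then have "N u \<le> N (x /\<^sub>R norm x)"
        by (intro u(2)) simp
      with False show ?thesis
        by (simp add: scale field_simps)
    qed (simp add: nonneg)
  qed
qed

lemma bdd_above_dual_norm:
  fixes N :: "'a::euclidean_space \<Rightarrow> real"
  assumes "is_norm N"
  shows "bdd_above {u \<bullet> x | x. N x \<le> 1}"
proof -
  obtain k where k: "k > 0" "\<And>x. k * norm x \<le> N x"
    using is_norm_lower_bound[OF assms] by blast
  have "u \<bullet> x \<le> norm u / k" if "N x \<le> 1" for x
  proof -
    have "k * norm x \<le> 1"
      using k(2) that by (rule order_trans)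
    then have "norm x \<le> 1 / k"
      using k(1) by (simp add: field_simps)
    then show ?thesis
      using norm_cauchy_schwarz[of u x] mult_left_mono[of "norm x" "1/k" "norm u"] by simp
  qed
  then show ?thesis
    by (auto simp: bdd_above_def)
qed

lemma dual_norm_pos:
  fixes N :: "'a::euclidean_space \<Rightarrow> real"
  assumes N: "is_norm N" and "u \<noteq> 0"
  shows "dual_norm N u > 0"
proof -
  have "N u > 0"
    using assms by (metis is_norm_def less_eq_real_def)
  moreover have "N (u /\<^sub>R N u) = \<bar>inverse (N u)\<bar> * N u"
    using N by (simp add: is_norm_def)
  ultimately have "N (u /\<^sub>R N u) \<le> 1"
    by simp
  then have "u \<bullet> (u /\<^sub>R N u) \<le> dual_norm N u"
    unfolding dual_norm_def by (intro cSup_upper bdd_above_dual_norm N) blast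
  moreover have "u \<bullet> (u /\<^sub>R N u) > 0"
    using \<open>N u > 0\<close> \<open>u \<noteq> 0\<close> by simp
  ultimately show ?thesis
    by simp
qed

lemma dual_norm_scaleR_nonneg:
  fixes N :: "'a::euclidean_space \<Rightarrow> real"
  assumes N: "is_norm N" and "r \<ge> 0"
  shows "dual_norm N (r *\<^sub>R u) = r * dual_norm N u"
proof -
  have zero: "N 0 \<le> 1"
    using N by (metis is_norm_def zero_le_one)
  show ?thesis
  proof (cases "r = 0")
    case True
    have "{(0::'a) \<bullet> x | x. N x \<le> 1} = {0}"
      using zero by auto
    with True show ?thesis
      by (simp add: dual_norm_def)
  next
    case False
    with \<open>r \<ge> 0\<close> have "r > 0" by simp
    have upper: "u \<bullet> x \<le> dual_norm N u" if "N x \<le> 1" for x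
      unfolding dual_norm_def using that by (intro cSup_upper bdd_above_dual_norm N) auto
    show ?thesis
      unfolding dual_norm_def[of N "r *\<^sub>R u"]
    proof (rule cSup_eq_non_empty)
      show "{(r *\<^sub>R u) \<bullet> x | x. N x \<le> 1} \<noteq> {}"
        using zero by auto
      show "v \<le> r * dual_norm N u" if "v \<in> {(r *\<^sub>R u) \<bullet> x | x. N x \<le> 1}" for v
        using that upper \<open>r > 0\<close> by auto
      fix v assume v: "\<And>w. w \<in> {(r *\<^sub>R u) \<bullet> x | x. N x \<le> 1} \<Longrightarrow> w \<le> v"
      have "dual_norm N u \<le> v / r"
        unfolding dual_norm_def
      proof (rule cSup_least)
        show "{u \<bullet> x | x. N x \<le> 1} \<noteq> {}"
          using zero by auto
        fix w assume "w \<in> {u \<bullet> x | x. N x \<le> 1}"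
        then have "r * w \<le> v"
          by (intro v) auto
        with \<open>r > 0\<close> show "w \<le> v / r"
          by (simp add: field_simps)
      qed
      with \<open>r > 0\<close> show "r * dual_norm N u \<le> v"
        by (simp add: field_simps)
    qed
  qed
qed

lemma dual_norm_abs_1: "dual_norm abs (1::real) = 1"
  unfolding dual_norm_def by (rule cSup_eq_maximum) auto

section \<open>Normal cones of half-spaces\<close>

lemma normal_cone_polar_halfspace:
  "- z \<in> normal_cone 0 (polar_halfspace c) \<longleftrightarrow> (\<exists>r\<ge>0. z = r *\<^sub>R c)"
proof
  assume "- z \<in> normal_cone 0 (polar_halfspace c)"
  then have z: "z \<bullet> u \<ge> 0" if "c \<bullet> u \<ge> 0" for u
    using that by (simp add: normal_cone_def polar_halfspace_def)
  define r where "r = (z \<bullet> c) / (c \<bullet> c)"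
  \<comment> \<open>the component of \<^term>\<open>z\<close> orthogonal to \<^term>\<open>c\<close>; its negative lies in the half-space\<close>
  define u where "u = z - r *\<^sub>R c"
  have "c \<bullet> u = 0"
    by (cases "c = 0") (auto simp: u_def r_def inner_diff_right inner_commute)
  then have "z \<bullet> (- u) \<ge> 0"
    by (intro z) simp
  moreover have "z \<bullet> u = u \<bullet> u"
    using \<open>c \<bullet> u = 0\<close> by (simp add: u_def inner_diff_left)
  ultimately have "u \<bullet> u \<le> 0"
    by simp
  then have "u = 0"
    by (metis inner_eq_zero_iff inner_ge_zero order_antisym)
  moreover have "r \<ge> 0"
    using z[of c] by (simp add: r_def)
  ultimately show "\<exists>r\<ge>0. z = r *\<^sub>R c"
    by (auto simp: u_def)
next
  assume "\<exists>r\<ge>0. z = r *\<^sub>R c"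
  then show "- z \<in> normal_cone 0 (polar_halfspace c)"
    by (auto simp: normal_cone_def polar_halfspace_def)
qed

lemma normal_cone_atLeast_0:
  fixes z :: real
  shows "- z \<in> normal_cone 0 {0..} \<longleftrightarrow> z \<ge> 0"
  by (auto simp: normal_cone_def dest: bspec[of _ _ 1])

section \<open>Existence of optimal solutions\<close>

lemma convex_cone_sum:
  assumes "convex_cone S" "\<And>i. i \<in> A \<Longrightarrow> f i \<in> S"
  shows "sum f A \<in> S"
  using assms(2)
  by (induction A rule: infinite_finite_induct)
    (auto intro: convex_cone_add convex_cone_contains_0 assms(1))

lemma convex_cone_hull_Basis:
  "convex_cone hull (Basis :: 'a::euclidean_space set) = {v. \<forall>i\<in>Basis. v \<bullet> i \<ge> 0}"
proof
  have "convex_cone {v::'a. \<forall>i\<in>Basis. v \<bullet> i \<ge> 0}"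
    by (auto simp: convex_cone_iff inner_add_left)
  then show "convex_cone hull (Basis :: 'a set) \<subseteq> {v. \<forall>i\<in>Basis. v \<bullet> i \<ge> 0}"
    by (intro hull_minimal) (auto simp: inner_Basis)
  show "{v. \<forall>i\<in>Basis. v \<bullet> i \<ge> 0} \<subseteq> convex_cone hull (Basis :: 'a set)"
  proof
    fix v :: 'a assume "v \<in> {v. \<forall>i\<in>Basis. v \<bullet> i \<ge> 0}"
    then have "(\<Sum>i\<in>Basis. (v \<bullet> i) *\<^sub>R i) \<in> convex_cone hull Basis"
      by (intro convex_cone_sum[OF convex_cone_convex_cone_hull] convex_cone_hull_mul hull_inc) auto
    then show "v \<in> convex_cone hull Basis"
      by (simp add: euclidean_representation)
  qed
qed

lemma convex_cone_hull_symmetric_Basis: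
  "convex_cone hull (Basis \<union> uminus ` Basis) = (UNIV :: 'a::euclidean_space set)"
proof -
  let ?C = "convex_cone hull (Basis \<union> uminus ` Basis) :: 'a set"
  have "(v \<bullet> i) *\<^sub>R i \<in> ?C" if "i \<in> Basis" for v i :: 'a
  proof (cases "v \<bullet> i \<ge> 0")
    case True
    with that show ?thesis
      by (intro convex_cone_hull_mul hull_inc) auto
  next
    case False
    then have "(- (v \<bullet> i)) *\<^sub>R (- i) \<in> ?C"
      using that by (intro convex_cone_hull_mul hull_inc) auto
    then show ?thesis
      by simp
  qed
  then have "(\<Sum>i\<in>Basis. (v \<bullet> i) *\<^sub>R i) \<in> ?C" for v
    by (intro convex_cone_sum convex_cone_convex_cone_hull)
  then show ?thesis
    by (auto simp: euclidean_representation)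
qed

text \<open>
  A right-hand side for which \<^term>\<open>x\<close> is feasible is the vector of all \<open>a t \<bullet> x\<close> plus a nonnegative
  slack vector. The pairs below therefore form the image of a space times an orthant under a linear
  map, and both factors are finitely generated cones.
\<close>

lemma lp_values_convex_cone:
  fixes a :: "'m::finite \<Rightarrow> real^'n" and c :: "real^'n"
  obtains G where "finite G" "convex_cone hull G = {(b, c \<bullet> x) | b x. x \<in> feasible a b}"
proof -
  define p :: "real^'n \<Rightarrow> (real^'m) \<times> real" where "p = (\<lambda>x. (\<chi> t. a t \<bullet> x, c \<bullet> x))"
  define q :: "real^'m \<Rightarrow> (real^'m) \<times> real" where "q = (\<lambda>s. (s, 0))"
  have "linear p"
    by (rule linearI) (auto simp: p_def vec_eq_iff inner_add_right)
  have "linear q"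
    by (rule linearI) (auto simp: q_def)
  define G where "G = p ` (Basis \<union> uminus ` Basis) \<union> q ` Basis"
  have "convex_cone hull G = (\<Union>u\<in>range p. \<Union>v\<in>q ` {s. \<forall>i\<in>Basis. s \<bullet> i \<ge> 0}. {u + v})"
    unfolding G_def convex_cone_hull_Un[of "p ` _"] convex_cone_hull_linear_image[OF \<open>linear p\<close>]
      convex_cone_hull_linear_image[OF \<open>linear q\<close>]
      convex_cone_hull_symmetric_Basis convex_cone_hull_Basis ..
  also have "\<dots> = {p x + q s | x s. \<forall>t. s $ t \<ge> 0}"
    by (auto simp: Basis_vec_def inner_axis)
  also have "\<dots> = {(b, c \<bullet> x) | b x. x \<in> feasible a b}"
  proof (intro equalityI subsetI)
    fix w assume "w \<in> {p x + q s | x s. \<forall>t. s $ t \<ge> 0}"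
    then show "w \<in> {(b, c \<bullet> x) | b x. x \<in> feasible a b}"
      by (force simp: p_def q_def feasible_def)
  next
    fix w assume "w \<in> {(b, c \<bullet> x) | b x. x \<in> feasible a b}"
    then obtain b x where "w = (b, c \<bullet> x)" "x \<in> feasible a b"
      by blast
    then have "w = p x + q (\<chi> t. b $ t - a t \<bullet> x)" "\<forall>t. (\<chi> t. b $ t - a t \<bullet> x) $ t \<ge> 0"
      by (auto simp: p_def q_def feasible_def vec_eq_iff)
    then show "w \<in> {p x + q s | x s. \<forall>t. s $ t \<ge> 0}"
      by blast
  qed
  finally have "convex_cone hull G = {(b, c \<bullet> x) | b x. x \<in> feasible a b}" .
  moreover have "finite G"
    by (simp add: G_def)
  ultimately show thesis
    using that by blast
qed

lemma closed_lp_values: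
  fixes a :: "'m::finite \<Rightarrow> real^'n"
  shows "closed ((\<bullet>) c ` feasible a b)"
proof -
  obtain G where G: "finite G" "convex_cone hull G = {(b, c \<bullet> x) | b x. x \<in> feasible a b}"
    by (rule lp_values_convex_cone)
  have "(\<bullet>) c ` feasible a b = Pair b -` (convex_cone hull G)"
    by (auto simp: G(2))
  moreover have "closed (Pair b -` (convex_cone hull G))"
    by (intro closed_vimage closed_convex_cone_hull G(1) continuous_intros)
  ultimately show ?thesis
    by simp
qed

text \<open>
  Each functional \<open>a t\<close> is bounded above on the feasible set, by its right-hand side, and boundedness
  above is inherited by conic combinations. This is weak duality without explicit multipliers.
\<close>

lemma bdd_below_lp_values:
  assumes "- c \<in> convex_cone hull (range a)"
  shows "bdd_below ((\<bullet>) c ` feasible a b)"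
proof -
  define C where "C = {d. \<exists>u. \<forall>x\<in>feasible a b. d \<bullet> x \<le> u}"
  have "range a \<subseteq> C"
    by (auto simp: C_def feasible_def)
  moreover have "convex_cone C"
    unfolding convex_cone_iff
  proof (intro conjI ballI allI impI)
    show "0 \<in> C"
      by (auto simp: C_def)
    show "d + e \<in> C" if "d \<in> C" "e \<in> C" for d e
      using that unfolding C_def mem_Collect_eq inner_add_left by (meson add_mono)
    show "r *\<^sub>R d \<in> C" if "d \<in> C" "r \<ge> 0" for d r
      using that unfolding C_def mem_Collect_eq inner_scaleR_left by (meson mult_left_mono)
  qed
  ultimately have "convex_cone hull (range a) \<subseteq> C"
    by (rule hull_minimal)
  with assms have "- c \<in> C"
    by blast
  then obtain u where "\<And>x. x \<in> feasible a b \<Longrightarrow> - c \<bullet> x \<le> u"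
    unfolding C_def by blast
  then have "- u \<le> c \<bullet> x" if "x \<in> feasible a b" for x
    using that by force
  then show ?thesis
    by (auto simp: bdd_below_def)
qed

lemma solutions_nonempty_iff_feasible:
  fixes a :: "'m::finite \<Rightarrow> real^'n"
  assumes "- c \<in> convex_cone hull (range a)"
  shows "solutions a c b \<noteq> {} \<longleftrightarrow> feasible a b \<noteq> {}"
proof
  assume "feasible a b \<noteq> {}"
  then have "Inf ((\<bullet>) c ` feasible a b) \<in> (\<bullet>) c ` feasible a b"
    by (intro closed_contains_Inf closed_lp_values bdd_below_lp_values assms) simp
  then obtain x where "x \<in> feasible a b" "c \<bullet> x = Inf ((\<bullet>) c ` feasible a b)"
    by auto
  then have "x \<in> solutions a c b"
    by (auto simp: solutions_def intro!: cInf_lower bdd_below_lp_values assms)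
  then show "solutions a c b \<noteq> {}"
    by blast
qed (auto simp: solutions_def)

lemma opt_val_eq:
  assumes "x \<in> solutions a c b"
  shows "opt_val a c b = c \<bullet> x"
  unfolding opt_val_def using assms by (intro cInf_eq_minimum) (auto simp: solutions_def)

section \<open>The subdifferentials as systems of linear inequalities\<close>

lemma coderivative_epi_map_iff:
  "y \<in> coderivative (epi_map \<Theta> M) b z w \<longleftrightarrow>
    (\<forall>b' z' u. z' \<in> M b' \<longrightarrow> u \<in> \<Theta> \<longrightarrow> y \<bullet> (b' - b) \<le> w \<bullet> (z' + u - z))"
  unfolding coderivative_def normal_cone_def gph_def epi_map_def set_plus_def
  by (fastforce simp: inner_Pair)

lemma subdiff_opt_val_iff:
  assumes x: "x \<in> solutions a c b"
  shows "y \<in> subdiff_opt_val a c b \<longleftrightarrow>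
    (\<forall>b'. \<forall>x'\<in>solutions a c b'. y \<bullet> (b' - b) \<le> c \<bullet> x' - c \<bullet> x)"
proof -
  have "- w \<in> normal_cone 0 {0..} \<and> dual_norm abs w = 1 \<longleftrightarrow> w = 1" for w :: real
    using dual_norm_scaleR_nonneg[OF is_norm_abs, of w 1]
    by (auto simp: normal_cone_atLeast_0 dual_norm_abs_1)
  then have "y \<in> subdiff_opt_val a c b \<longleftrightarrow>
      y \<in> coderivative (epi_map {0..} (opt_val_map a c)) b (c \<bullet> x) 1"
    by (auto simp: subdiff_opt_val_def subdifferential_def opt_val_eq[OF x])
  also have "\<dots> \<longleftrightarrow> (\<forall>b'. \<forall>x'\<in>solutions a c b'. \<forall>u\<ge>0. y \<bullet> (b' - b) \<le> c \<bullet> x' + u - c \<bullet> x)"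
    by (auto simp: coderivative_epi_map_iff opt_val_map_def)
  also have "\<dots> \<longleftrightarrow> (\<forall>b'. \<forall>x'\<in>solutions a c b'. y \<bullet> (b' - b) \<le> c \<bullet> x' - c \<bullet> x)"
    by (smt (verit))
  finally show ?thesis .
qed

lemma subdiff_feasible_iff:
  fixes a :: "'m::finite \<Rightarrow> real^'n"
  assumes N: "is_norm N" and "c \<noteq> 0"
  shows "y \<in> subdiff_feasible N a c b x \<longleftrightarrow>
    (\<forall>b'. \<forall>x'\<in>feasible a b'. (dual_norm N c *\<^sub>R y) \<bullet> (b' - b) \<le> c \<bullet> x' - c \<bullet> x)"
proof -
  define \<kappa> where "\<kappa> = dual_norm N c"
  have "\<kappa> > 0"
    unfolding \<kappa>_def using assms by (rule dual_norm_pos)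
  have "- w \<in> normal_cone 0 (polar_halfspace c) \<and> dual_norm N w = 1 \<longleftrightarrow> w = c /\<^sub>R \<kappa>" for w
    using dual_norm_scaleR_nonneg[OF N, of _ c] \<open>\<kappa> > 0\<close>
    by (auto simp: normal_cone_polar_halfspace \<kappa>_def[symmetric] field_simps intro!: exI[of _ "inverse \<kappa>"])
  then have coderivative: "y \<in> subdiff_feasible N a c b x \<longleftrightarrow>
      y \<in> coderivative (epi_map (polar_halfspace c) (feasible a)) b x (c /\<^sub>R \<kappa>)"
    by (auto simp: subdiff_feasible_def subdifferential_def)
  have rescale: "y \<bullet> d \<le> (c /\<^sub>R \<kappa>) \<bullet> v \<longleftrightarrow> (\<kappa> *\<^sub>R y) \<bullet> d \<le> c \<bullet> v" for d v
    using pos_le_divide_eq[OF \<open>\<kappa> > 0\<close>, of "y \<bullet> d" "c \<bullet> v"]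
    by (simp add: divide_inverse mult.commute)
  have "y \<in> subdiff_feasible N a c b x \<longleftrightarrow> (\<forall>b'. \<forall>x'\<in>feasible a b'. \<forall>u. c \<bullet> u \<ge> 0 \<longrightarrow>
      (\<kappa> *\<^sub>R y) \<bullet> (b' - b) \<le> c \<bullet> (x' + u - x))"
    unfolding coderivative coderivative_epi_map_iff rescale by (auto simp: polar_halfspace_def)
  also have "\<dots> \<longleftrightarrow> (\<forall>b'. \<forall>x'\<in>feasible a b'. \<forall>u. c \<bullet> u \<ge> 0 \<longrightarrow>
      (\<kappa> *\<^sub>R y) \<bullet> (b' - b) \<le> c \<bullet> x' + c \<bullet> u - c \<bullet> x)"
    by (simp only: inner_diff_right[of c] inner_add_right)
  also have "\<dots> \<longleftrightarrow> (\<forall>b'. \<forall>x'\<in>feasible a b'. (\<kappa> *\<^sub>R y) \<bullet> (b' - b) \<le> c \<bullet> x' - c \<bullet> x)"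
    by (smt (verit) inner_zero_right)
  finally show ?thesis
    by (simp only: \<kappa>_def)
qed

section \<open>The subdifferential of the optimal value\<close>

theorem proposition3:
  fixes a :: "'m::finite \<Rightarrow> real^'n"
    and c x :: "real^'n"
    and b :: "real^'m"
    and N :: "real^'n \<Rightarrow> real"
  assumes "is_norm N"
    and "c \<noteq> 0"
    and "- c \<in> convex_cone hull (range a)"
    and "(b, x) \<in> gph (solutions a c)"
  shows "subdiff_opt_val a c b = (*\<^sub>R) (dual_norm N c) ` subdiff_feasible N a c b x"
proof -
  define \<kappa> where "\<kappa> = dual_norm N c"
  have "\<kappa> > 0"
    unfolding \<kappa>_def using assms(1,2) by (rule dual_norm_pos)
  have x: "x \<in> solutions a c b"
    using assms(4) by (simp add: gph_def)
  have opt_val_iff: "y \<in> subdiff_opt_val a c b \<longleftrightarrow>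
      (\<forall>b'. \<forall>x'\<in>feasible a b'. y \<bullet> (b' - b) \<le> c \<bullet> x' - c \<bullet> x)" for y
  proof -
    have "\<exists>s\<in>solutions a c b'. c \<bullet> s \<le> c \<bullet> x'" if "x' \<in> feasible a b'" for b' x'
      using that solutions_nonempty_iff_feasible[OF assms(3), of b'] by (auto simp: solutions_def)
    moreover have "solutions a c b' \<subseteq> feasible a b'" for b'
      by (auto simp: solutions_def)
    ultimately show ?thesis
      unfolding subdiff_opt_val_iff[OF x] by (smt (verit) subsetD)
  qed
  have "y \<in> subdiff_feasible N a c b x \<longleftrightarrow> \<kappa> *\<^sub>R y \<in> subdiff_opt_val a c b" for y
    unfolding opt_val_iff \<kappa>_def using assms(1,2) by (rule subdiff_feasible_iff)
  moreover have "y = \<kappa> *\<^sub>R (y /\<^sub>R \<kappa>)" for y :: "real^'m"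
    using \<open>\<kappa> > 0\<close> by simp
  ultimately show ?thesis
    unfolding \<kappa>_def[symmetric] by (metis (no_types, lifting) image_eqI image_subset_iff subset_antisym subsetI)
qed

end
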